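(* Let $\Phi=(A;\{E_i\}_{i=0}^d;A^*;\{E^*_i\}_{i=0}^d)$ be a Leonard system in $\mathcal{A}$ with first split sequence $\{\varphi_i\}_{i=1}^d$ and second split sequence $\{\phi_i\}_{i=1}^d$. The switching element $S=\sum_{r=0}^d\frac{\phi_d\phi_{d-1}\cdots\phi_{d-r+1}}{\varphi_1\varphi_2\cdots\varphi_r}E_r$ and the dual switching element $S^*=\sum_{r=0}^d\frac{\phi_1\phi_2\cdots\phi_r}{\varphi_1\varphi_2\cdots\varphi_r}E^*_r$ are invertible with $$S^{-1}=\sum_{r=0}^d\frac{\varphi_1\varphi_2\cdots\varphi_r}{\phi_d\phi_{d-1}\cdots\phi_{d-r+1}}E_r,\qquad S^{*-1}=\sum_{r=0}^d\frac{\varphi_1\varphi_2\cdots\varphi_r}{\phi_1\phi_2\cdots\phi_r}E^*_r.$$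
   Context: $\mathbb{K}$ is a field, $d\ge 0$ an integer, $\mathcal{A}$ a $\mathbb{K}$-algebra isomorphic to $\mathrm{Mat}_{d+1}(\mathbb{K})$, and $I$ its identity. The symbol $A^*$ is just a name for a second element (not a conjugate transpose). An element $A\in\mathcal{A}$ is multiplicity-free if it has $d+1$ mutually distinct eigenvalues in $\mathbb{K}$. For an ordering $\{\theta_i\}_{i=0}^d$ of these eigenvalues, the primitive idempotent of $A$ associated with $\theta_i$ is $E_i=\prod_{0\le j\le d,\,j\ne i}\frac{A-\theta_jI}{\theta_i-\theta_j}$. A Leonard system in $\mathcal{A}$ is a sequence $\Phi=(A;\{E_i\}_{i=0}^d;A^*;\{E^*_i\}_{i=0}^d)$ such that $A,A^*\in\mathcal{A}$ are multiplicity-free; $\{E_i\}_{i=0}^d$ (resp. $\{E^*_i\}_{i=0}^d$) is an ordering of the primitive idempotents of $A$ (resp. $A^*$); and for $0\le i,j\le d$ both $E_iA^*E_j$ and $E^*_iAE^*_j$ are zero if $|i-j|>1$ and nonzero if $|i-j|=1$. Let $\theta_i$ (resp. $\theta^*_i$) be the eigenvalue of $A$ (resp. $A^*$) associated with $E_i$ (resp. $E^*_i$). Put $\tau_i=(\lambda-\theta_0)(\lambda-\theta_1)\cdots(\lambda-\theta_{i-1})$ and $\eta_i=(\lambda-\theta_d)(\lambda-\theta_{d-1})\cdots(\lambda-\theta_{d-i+1})$ for $0\le i\le d$. The first and second split sequences of $\Phi$ are, for $1\le i\le d$, $\varphi_i=(\theta^*_0-\theta^*_i)\frac{\mathrm{tr}(\tau_i(A)E^*_0)}{\mathrm{tr}(\tau_{i-1}(A)E^*_0)}$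 and $\phi_i=(\theta^*_0-\theta^*_i)\frac{\mathrm{tr}(\eta_i(A)E^*_0)}{\mathrm{tr}(\eta_{i-1}(A)E^*_0)}$ (the denominators are known to be nonzero, and all $\varphi_i,\phi_i$ are known to be nonzero). *)

theory Defs
  imports "Jordan_Normal_Form.Char_Poly"
begin

locale unital_algebra = Vector_Spaces.vector_space scale
  for scale :: "'k::field \<Rightarrow> 'a::ring_1 \<Rightarrow> 'a" +
  assumes scale_mult_left: "scale c x * y = scale c (x * y)"
    and scale_mult_right: "x * scale c y = scale c (x * y)"

(* A K-algebra together with a K-algebra isomorphism onto the square matrices of size d + 1.
   Eigenvalues and traces of elements of the algebra are read off through rep; by the
   Skolem-Noether theorem they do not depend on the isomorphism chosen. *)
locale matrix_algebra = unital_algebra scale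
  for scale :: "'k::field \<Rightarrow> 'a::ring_1 \<Rightarrow> 'a" +
  fixes d :: nat and rep :: "'a \<Rightarrow> 'k mat"
  assumes rep_bij: "bij_betw rep UNIV (carrier_mat (d + 1) (d + 1))"
    and rep_add: "rep (x + y) = rep x + rep y"
    and rep_mult: "rep (x * y) = rep x * rep y"
    and rep_one: "rep 1 = 1\<^sub>m (d + 1)"
    and rep_scale: "rep (scale c x) = c \<cdot>\<^sub>m rep x"

definition alg_eigenvalues :: "('a \<Rightarrow> 'k::field mat) \<Rightarrow> 'a \<Rightarrow> 'k set" where
  "alg_eigenvalues rep A = {t. eigenvalue (rep A) t}"

definition alg_trace :: "('a \<Rightarrow> 'k::field mat) \<Rightarrow> 'a \<Rightarrow> 'k" where
  "alg_trace rep A = (\<Sum>i<dim_row (rep A). rep A $$ (i, i))"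

definition alg_poly :: "('k::field \<Rightarrow> 'a::ring_1 \<Rightarrow> 'a) \<Rightarrow> 'k poly \<Rightarrow> 'a \<Rightarrow> 'a" where
  "alg_poly scale p A = (\<Sum>i\<le>degree p. scale (coeff p i) (A ^ i))"

definition multiplicity_free :: "nat \<Rightarrow> ('a \<Rightarrow> 'k::field mat) \<Rightarrow> 'a \<Rightarrow> bool" where
  "multiplicity_free d rep A \<longleftrightarrow> card (alg_eigenvalues rep A) = d + 1"

definition eigenvalue_ordering ::
    "nat \<Rightarrow> ('a \<Rightarrow> 'k::field mat) \<Rightarrow> 'a \<Rightarrow> (nat \<Rightarrow> 'k) \<Rightarrow> bool" where
  "eigenvalue_ordering d rep A \<theta> \<longleftrightarrow> bij_betw \<theta> {0..d} (alg_eigenvalues rep A)"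

(* The factors commute; a list product is used because the ambient ring is not commutative. *)
definition primitive_idempotent ::
    "('k::field \<Rightarrow> 'a::ring_1 \<Rightarrow> 'a) \<Rightarrow> nat \<Rightarrow> 'a \<Rightarrow> (nat \<Rightarrow> 'k) \<Rightarrow> nat \<Rightarrow> 'a" where
  "primitive_idempotent scale d A \<theta> i =
     (\<Prod>j\<leftarrow>filter (\<lambda>j. j \<noteq> i) [0..<d + 1].
        scale (1 / (\<theta> i - \<theta> j)) (A - scale (\<theta> j) 1))"

(* E is an ordering of the primitive idempotents of A, and \<theta> i is the eigenvalue of A
   associated with E i. Only indices in {0..d} matter. *)
definition idempotent_ordering ::
    "('k::field \<Rightarrow> 'a::ring_1 \<Rightarrow> 'a) \<Rightarrow> nat \<Rightarrow> ('a \<Rightarrow> 'k mat) \<Rightarrow> 'a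
     \<Rightarrow> (nat \<Rightarrow> 'a) \<Rightarrow> (nat \<Rightarrow> 'k) \<Rightarrow> bool" where
  "idempotent_ordering scale d rep A E \<theta> \<longleftrightarrow>
     eigenvalue_ordering d rep A \<theta> \<and>
     (\<forall>i\<in>{0..d}. E i = primitive_idempotent scale d A \<theta> i)"

(* As and Es stand for the second element A^* and its idempotents E^*_i. *)
locale leonard_system = matrix_algebra scale d rep
  for scale :: "'k::field \<Rightarrow> 'a::ring_1 \<Rightarrow> 'a" and d :: nat and rep :: "'a \<Rightarrow> 'k mat" +
  fixes A :: 'a and E :: "nat \<Rightarrow> 'a" and As :: 'a and Es :: "nat \<Rightarrow> 'a"
  assumes mult_free: "multiplicity_free d rep A"
    and mult_free_dual: "multiplicity_free d rep As"
    and idempotents: "\<exists>\<theta>. idempotent_ordering scale d rep A E \<theta>"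
    and idempotents_dual: "\<exists>\<theta>s. idempotent_ordering scale d rep As Es \<theta>s"
    and tridiag_zero: "\<lbrakk>i \<le> d; j \<le> d; \<bar>int i - int j\<bar> > 1\<rbrakk> \<Longrightarrow> E i * As * E j = 0"
    and tridiag_nonzero: "\<lbrakk>i \<le> d; j \<le> d; \<bar>int i - int j\<bar> = 1\<rbrakk> \<Longrightarrow> E i * As * E j \<noteq> 0"
    and tridiag_dual_zero: "\<lbrakk>i \<le> d; j \<le> d; \<bar>int i - int j\<bar> > 1\<rbrakk> \<Longrightarrow> Es i * A * Es j = 0"
    and tridiag_dual_nonzero: "\<lbrakk>i \<le> d; j \<le> d; \<bar>int i - int j\<bar> = 1\<rbrakk> \<Longrightarrow> Es i * A * Es j \<noteq> 0"

definition tau_poly :: "(nat \<Rightarrow> 'k::field) \<Rightarrow> nat \<Rightarrow> 'k poly" where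
  "tau_poly \<theta> i = (\<Prod>h<i. [:- \<theta> h, 1:])"

definition eta_poly :: "nat \<Rightarrow> (nat \<Rightarrow> 'k::field) \<Rightarrow> nat \<Rightarrow> 'k poly" where
  "eta_poly d \<theta> i = (\<Prod>h<i. [:- \<theta> (d - h), 1:])"

(* The split sequences are indexed by 1..d; values at other indices are irrelevant. *)
definition first_split_sequence ::
    "('k::field \<Rightarrow> 'a::ring_1 \<Rightarrow> 'a) \<Rightarrow> ('a \<Rightarrow> 'k mat) \<Rightarrow> 'a \<Rightarrow> (nat \<Rightarrow> 'a)
     \<Rightarrow> (nat \<Rightarrow> 'k) \<Rightarrow> (nat \<Rightarrow> 'k) \<Rightarrow> nat \<Rightarrow> 'k" where
  "first_split_sequence scale rep A Es \<theta> \<theta>s i =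
     (\<theta>s 0 - \<theta>s i) *
     (alg_trace rep (alg_poly scale (tau_poly \<theta> i) A * Es 0) /
      alg_trace rep (alg_poly scale (tau_poly \<theta> (i - 1)) A * Es 0))"

definition second_split_sequence ::
    "('k::field \<Rightarrow> 'a::ring_1 \<Rightarrow> 'a) \<Rightarrow> nat \<Rightarrow> ('a \<Rightarrow> 'k mat) \<Rightarrow> 'a \<Rightarrow> (nat \<Rightarrow> 'a)
     \<Rightarrow> (nat \<Rightarrow> 'k) \<Rightarrow> (nat \<Rightarrow> 'k) \<Rightarrow> nat \<Rightarrow> 'k" where
  "second_split_sequence scale d rep A Es \<theta> \<theta>s i =
     (\<theta>s 0 - \<theta>s i) *
     (alg_trace rep (alg_poly scale (eta_poly d \<theta> i) A * Es 0) /
      alg_trace rep (alg_poly scale (eta_poly d \<theta> (i - 1)) A * Es 0))"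

(* In the next two definitions \<phi>1 and \<phi>2 are the first and second split sequences. *)
definition switching_element ::
    "('k::field \<Rightarrow> 'a::ring_1 \<Rightarrow> 'a) \<Rightarrow> nat \<Rightarrow> (nat \<Rightarrow> 'a) \<Rightarrow> (nat \<Rightarrow> 'k) \<Rightarrow> (nat \<Rightarrow> 'k) \<Rightarrow> 'a" where
  "switching_element scale d E \<phi>1 \<phi>2 =
     (\<Sum>r=0..d. scale ((\<Prod>h<r. \<phi>2 (d - h)) / (\<Prod>h=1..r. \<phi>1 h)) (E r))"

definition dual_switching_element ::
    "('k::field \<Rightarrow> 'a::ring_1 \<Rightarrow> 'a) \<Rightarrow> nat \<Rightarrow> (nat \<Rightarrow> 'a) \<Rightarrow> (nat \<Rightarrow> 'k) \<Rightarrow> (nat \<Rightarrow> 'k) \<Rightarrow> 'a" where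
  "dual_switching_element scale d Es \<phi>1 \<phi>2 =
     (\<Sum>r=0..d. scale ((\<Prod>h=1..r. \<phi>2 h) / (\<Prod>h=1..r. \<phi>1 h)) (Es r))"

definition is_inverse_of :: "'a::ring_1 \<Rightarrow> 'a \<Rightarrow> bool" where
  "is_inverse_of y x \<longleftrightarrow> x * y = 1 \<and> y * x = 1"

end

theory Submission
  imports Defs
begin

text \<open>
  The primitive idempotents of a multiplicity-free element are orthogonal, so an element
  \<open>\<Sum>r. s\<^sub>r E\<^sub>r\<close> with all \<open>s\<^sub>r \<noteq> 0\<close> is inverted by \<open>\<Sum>r. s\<^sub>r\<inverse> E\<^sub>r\<close>. The content of the theorem is
  therefore that no entry of the two split sequences vanishes. Since the \<open>\<theta>\<^sup>*\<^sub>i\<close> are distinct,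
  this follows from \<open>tr(\<tau>\<^sub>i(A) E\<^sup>*\<^sub>0) \<noteq> 0\<close> and \<open>tr(\<eta>\<^sub>i(A) E\<^sup>*\<^sub>0) \<noteq> 0\<close>. The second claim is the first one for
  the Leonard system in which the order of the \<open>E\<^sub>i\<close> is reversed, which exchanges \<open>\<tau>\<^sub>i\<close> and \<open>\<eta>\<^sub>i\<close>.

  For the first claim put \<open>w = \<tau>\<^sub>i(A) E\<^sup>*\<^sub>0\<close>. As \<open>E\<^sup>*\<^sub>0\<close> has rank one, it suffices to show
  \<open>E\<^sup>*\<^sub>0 w \<noteq> 0\<close>. The element \<open>A\<close> is irreducible tridiagonal with respect to the \<open>E\<^sup>*\<^sub>j\<close>, so each
  factor \<open>A - \<theta>\<^sub>h\<close> of \<open>\<tau>\<^sub>i(A)\<close> raises the largest \<open>j\<close> with a nonzero component \<open>E\<^sup>*\<^sub>j y\<close> by exactly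
  one; hence \<open>E\<^sup>*\<^sub>j w = 0\<close> for \<open>j > i\<close>, and \<open>w \<noteq> 0\<close>. Suppose that \<open>E\<^sup>*\<^sub>0 w = 0\<close>. Then only the
  components \<open>E\<^sup>*\<^sub>1 w, \<dots>, E\<^sup>*\<^sub>i w\<close> are left, and \<open>(A\<^sup>* - \<theta>\<^sup>*\<^sub>1) \<cdots> (A\<^sup>* - \<theta>\<^sup>*\<^sub>i)\<close> annihilates \<open>w\<close>. On
  the other hand \<open>\<tau>\<^sub>i(A)\<close> annihilates \<open>E\<^sub>0, \<dots>, E\<^sub>i\<^sub>-\<^sub>1\<close>, so the smallest \<open>k\<close> with \<open>E\<^sub>k w \<noteq> 0\<close>
  satisfies \<open>k \<ge> i\<close>. Each of the \<open>i\<close> factors \<open>A\<^sup>* - \<theta>\<^sup>*\<^sub>j\<close> lowers this smallest index by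
  exactly one, so the product does not annihilate \<open>w\<close>, a contradiction.
\<close>

section \<open>Rank-one matrices\<close>

lemma rank_one_mult_entries:
  fixes M R N :: "'k::field mat"
  assumes "M \<in> carrier_mat n n" "R \<in> carrier_mat n n" "N \<in> carrier_mat n n"
    and R: "\<And>p q. p < n \<Longrightarrow> q < n \<Longrightarrow> R $$ (p, q) = u p * v q"
    and "p < n" "q < n"
  shows left_mult_rank_one_entry: "(M * R) $$ (p, q) = (\<Sum>k<n. M $$ (p, k) * u k) * v q"
    and right_mult_rank_one_entry: "(R * N) $$ (p, q) = u p * (\<Sum>k<n. v k * N $$ (k, q))"
  using assms
  by (auto simp: scalar_prod_def sum_distrib_left sum_distrib_right atLeast0LessThan mult.assoc
      intro!: sum.cong)

lemma rank_one_cancel_mat: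
  fixes M R N :: "'k::field mat"
  assumes M: "M \<in> carrier_mat n n" and Rc: "R \<in> carrier_mat n n" and N: "N \<in> carrier_mat n n"
    and R: "\<And>p q. p < n \<Longrightarrow> q < n \<Longrightarrow> R $$ (p, q) = u p * v q"
    and MR: "M * R \<noteq> 0\<^sub>m n n" and RN: "R * N \<noteq> 0\<^sub>m n n"
  shows "M * R * N \<noteq> 0\<^sub>m n n"
proof
  assume zero: "M * R * N = 0\<^sub>m n n"
  define a where "a p = (\<Sum>k<n. M $$ (p, k) * u k)" for p
  define b where "b q = (\<Sum>k<n. v k * N $$ (k, q))" for q
  have MRc: "M * R \<in> carrier_mat n n" using M Rc by simp
  have MR_entry: "(M * R) $$ (p, q) = a p * v q" if "p < n" "q < n" for p q
    unfolding a_def by (rule left_mult_rank_one_entry[OF M Rc N R that])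
  have RN_entry: "(R * N) $$ (p, q) = u p * b q" if "p < n" "q < n" for p q
    unfolding b_def by (rule right_mult_rank_one_entry[OF M Rc N R that])
  have MRN_entry: "(M * R * N) $$ (p, q) = a p * b q" if "p < n" "q < n" for p q
    unfolding b_def by (rule right_mult_rank_one_entry[OF M MRc N MR_entry that])
  have "\<exists>p<n. a p \<noteq> 0"
  proof (rule ccontr)
    assume "\<not> ?thesis"
    then have "M * R = 0\<^sub>m n n"
      using M Rc by (intro eq_matI) (simp_all add: MR_entry del: index_mult_mat(1))
    with MR show False by simp
  qed
  moreover have "\<exists>q<n. b q \<noteq> 0"
  proof (rule ccontr)
    assume "\<not> ?thesis"
    then have "R * N = 0\<^sub>m n n"
      using N Rc by (intro eq_matI) (simp_all add: RN_entry del: index_mult_mat(1))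
    with RN show False by simp
  qed
  ultimately obtain p q where "p < n" "q < n" "a p * b q \<noteq> 0" by auto
  with MRN_entry[of p q] zero show False by simp
qed

text \<open>Writing \<open>R = u v\<^sup>T\<close>, both sides are governed by the scalar \<open>v\<^sup>T M u\<close>: it is the trace of
  \<open>M R\<close>, and \<open>R M R\<close> is this multiple of \<open>R\<close>.\<close>

lemma rank_one_sandwich:
  fixes M R :: "'k::field mat"
  assumes M: "M \<in> carrier_mat n n" and Rc: "R \<in> carrier_mat n n"
    and R: "\<And>p q. p < n \<Longrightarrow> q < n \<Longrightarrow> R $$ (p, q) = u p * v q"
  shows "R * (M * R) = (\<Sum>p<n. (M * R) $$ (p, p)) \<cdot>\<^sub>m R"
proof (rule eq_matI)
  fix p q assume "p < dim_row ((\<Sum>p<n. (M * R) $$ (p, p)) \<cdot>\<^sub>m R)"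
    and "q < dim_col ((\<Sum>p<n. (M * R) $$ (p, p)) \<cdot>\<^sub>m R)"
  then have pq: "p < n" "q < n" using Rc by auto
  have MRc: "M * R \<in> carrier_mat n n" using M Rc by simp
  define a where "a p = (\<Sum>k<n. M $$ (p, k) * u k)" for p
  have MR_entry: "(M * R) $$ (p, q) = a p * v q" if "p < n" "q < n" for p q
    unfolding a_def by (rule left_mult_rank_one_entry[OF M Rc M R that])
  have "(R * (M * R)) $$ (p, q) = u p * (\<Sum>k<n. v k * (M * R) $$ (k, q))"
    by (rule right_mult_rank_one_entry[OF M Rc MRc R pq])
  also have "\<dots> = (\<Sum>k<n. (M * R) $$ (k, k)) * (u p * v q)"
    using pq by (simp add: MR_entry sum_distrib_left sum_distrib_right mult_ac
        del: index_mult_mat(1))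
  also have "\<dots> = ((\<Sum>k<n. (M * R) $$ (k, k)) \<cdot>\<^sub>m R) $$ (p, q)"
    using pq Rc by (simp add: R del: index_mult_mat(1))
  finally show "(R * (M * R)) $$ (p, q) = ((\<Sum>p<n. (M * R) $$ (p, p)) \<cdot>\<^sub>m R) $$ (p, q)" .
qed (use M Rc in auto)

section \<open>Complete systems of rank-one idempotents\<close>

context matrix_algebra
begin

lemma rep_carrier [simp]: "rep x \<in> carrier_mat (d + 1) (d + 1)"
  using rep_bij by (auto simp: bij_betw_def)

lemma rep_dim [simp]: "dim_row (rep x) = d + 1" "dim_col (rep x) = d + 1"
  using rep_carrier[of x] by (auto simp del: rep_carrier)

lemma rep_inject: "rep x = rep y \<longleftrightarrow> x = y"
  using rep_bij by (auto simp: bij_betw_def inj_on_def)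

lemma rep_zero: "rep 0 = 0\<^sub>m (d + 1) (d + 1)"
proof -
  have "rep 0 = rep (scale 0 0)" by simp
  also have "\<dots> = 0\<^sub>m (d + 1) (d + 1)" unfolding rep_scale by (rule eq_matI) auto
  finally show ?thesis .
qed

lemma rep_eq_zero_iff: "rep x = 0\<^sub>m (d + 1) (d + 1) \<longleftrightarrow> x = 0"
  using rep_inject[of x 0] by (simp add: rep_zero)

end

text \<open>What is used of the primitive idempotents of a multiplicity-free element. Rank one is
  expressed by the factorisation \<open>u v\<^sup>T\<close> of the representing matrix, which gives both the
  cancellation law and the trace criterion below.\<close>

locale idempotent_frame = matrix_algebra scale d rep
  for scale :: "'k::field \<Rightarrow> 'a::ring_1 \<Rightarrow> 'a" and d :: nat and rep :: "'a \<Rightarrow> 'k mat" +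
  fixes F :: "nat \<Rightarrow> 'a"
  assumes orthogonal: "\<lbrakk>i \<le> d; j \<le> d\<rbrakk> \<Longrightarrow> F i * F j = (if i = j then F i else 0)"
    and sum_one: "(\<Sum>i\<le>d. F i) = 1"
    and nonzero: "i \<le> d \<Longrightarrow> F i \<noteq> 0"
    and rank_one: "i \<le> d \<Longrightarrow> \<exists>u v. \<forall>p<d + 1. \<forall>q<d + 1. rep (F i) $$ (p, q) = u p * v q"
begin

lemma rank_one_cancel:
  assumes "i \<le> d" "X * F i \<noteq> 0" "F i * Y \<noteq> 0"
  shows "X * F i * Y \<noteq> 0"
proof -
  obtain u v where uv: "\<And>p q. p < d + 1 \<Longrightarrow> q < d + 1 \<Longrightarrow> rep (F i) $$ (p, q) = u p * v q"
    using rank_one[OF assms(1)] by blast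
  have "rep X * rep (F i) * rep Y \<noteq> 0\<^sub>m (d + 1) (d + 1)"
    using assms(2,3)
    by (intro rank_one_cancel_mat[OF rep_carrier rep_carrier rep_carrier uv])
      (simp_all add: rep_mult[symmetric] rep_eq_zero_iff del: One_nat_def add_Suc_right)
  then show ?thesis by (simp only: rep_mult[symmetric] rep_eq_zero_iff not_False_eq_True)
qed

lemma trace_nonzero:
  assumes "i \<le> d" "F i * (X * F i) \<noteq> 0"
  shows "alg_trace rep (X * F i) \<noteq> 0"
proof
  assume zero: "alg_trace rep (X * F i) = 0"
  obtain u v where uv: "\<And>p q. p < d + 1 \<Longrightarrow> q < d + 1 \<Longrightarrow> rep (F i) $$ (p, q) = u p * v q"
    using rank_one[OF assms(1)] by blast
  have "rep (F i * (X * F i)) = alg_trace rep (X * F i) \<cdot>\<^sub>m rep (F i)"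
    unfolding alg_trace_def rep_dim unfolding rep_mult
    by (rule rank_one_sandwich[OF rep_carrier rep_carrier uv])
  then have "rep (F i * (X * F i)) = rep (scale 0 (F i))" unfolding zero rep_scale .
  with assms(2) show False unfolding rep_inject by simp
qed

subsection \<open>Elements diagonal with respect to the idempotents\<close>

text \<open>The element with eigenvalue \<open>f i\<close> on the range of \<open>F i\<close>. Such elements multiply pointwise, so
  inverses, polynomials and annihilation are read off from eigenvalues.\<close>

definition spec :: "(nat \<Rightarrow> 'k) \<Rightarrow> 'a" where
  "spec f = (\<Sum>i\<le>d. scale (f i) (F i))"

lemma spec_cong: "(\<And>i. i \<le> d \<Longrightarrow> f i = g i) \<Longrightarrow> spec f = spec g"
  by (simp add: spec_def)

lemma idem_mult_spec: "j \<le> d \<Longrightarrow> F j * spec f = scale (f j) (F j)"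
  unfolding spec_def
  by (simp add: sum_distrib_left scale_mult_right orthogonal if_distrib[of "scale _"] sum.delta
      cong: if_cong)

lemma spec_const: "spec (\<lambda>i. c) = scale c 1"
  by (simp add: spec_def scale_sum_right[symmetric] sum_one)

lemma spec_mult: "spec f * spec g = spec (\<lambda>i. f i * g i)"
proof -
  have "spec f * spec g = (\<Sum>i\<le>d. scale (f i) (F i * spec g))"
    by (simp add: spec_def[of f] sum_distrib_right scale_mult_left)
  also have "\<dots> = spec (\<lambda>i. f i * g i)"
    by (simp add: idem_mult_spec spec_def[of "\<lambda>i. f i * g i"])
  finally show ?thesis .
qed

lemma spec_diff_const: "spec f - scale c 1 = spec (\<lambda>i. f i - c)"
  unfolding spec_const[symmetric] by (simp add: spec_def sum_subtractf scale_left_diff_distrib)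

lemma spec_sum: "(\<Sum>n\<in>N. spec (f n)) = spec (\<lambda>i. \<Sum>n\<in>N. f n i)"
  unfolding spec_def by (subst sum.swap) (simp add: scale_sum_left)

lemma scale_spec: "scale c (spec f) = spec (\<lambda>i. c * f i)"
  by (simp add: spec_def scale_sum_right)

lemma spec_power: "spec f ^ n = spec (\<lambda>i. f i ^ n)"
  by (induction n) (simp_all add: spec_mult spec_const)

lemma alg_poly_spec: "alg_poly scale p (spec f) = spec (\<lambda>i. poly p (f i))"
  by (simp add: alg_poly_def spec_power scale_spec spec_sum poly_altdef)

lemma prod_list_spec_diff:
  "prod_list (map (\<lambda>t. spec f - scale t 1) ts) = spec (\<lambda>i. \<Prod>t\<leftarrow>ts. f i - t)"
  by (induction ts) (simp_all add: spec_diff_const spec_mult spec_const)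

lemma inverse_spec:
  assumes "\<And>i. i \<le> d \<Longrightarrow> f i * g i = 1"
  shows "is_inverse_of (spec g) (spec f)"
proof -
  have "spec (\<lambda>i. f i * g i) = spec (\<lambda>i. 1)" "spec (\<lambda>i. g i * f i) = spec (\<lambda>i. 1)"
    by (auto intro!: spec_cong simp: assms mult.commute[of "g _"])
  then show ?thesis by (simp add: is_inverse_of_def spec_mult spec_const)
qed

lemma decompose: "(\<Sum>s\<le>d. X * F s * y) = X * y"
  by (simp add: sum_distrib_left[symmetric] sum_distrib_right[symmetric] sum_one)

lemma eq_zero_if_components_zero: "(\<And>s. s \<le> d \<Longrightarrow> F s * y = 0) \<Longrightarrow> y = 0"
  using decompose[of 1 y] by simp

subsection \<open>Tridiagonal elements raise the top index by one\<close>

definition top_index :: "nat \<Rightarrow> 'a \<Rightarrow> bool" where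
  "top_index k y \<longleftrightarrow> F k * y \<noteq> 0 \<and> (\<forall>r. k < r \<and> r \<le> d \<longrightarrow> F r * y = 0)"

text \<open>In \<open>F\<^sub>r X y = (\<Sum>s. F\<^sub>r X F\<^sub>s y)\<close> with \<open>r > k\<close> only \<open>s = k\<close> can contribute, and only for
  \<open>r = k + 1\<close>. That this one contribution is nonzero is where rank one enters: neither
  \<open>F\<^sub>k\<^sub>+\<^sub>1 X F\<^sub>k\<close> nor \<open>F\<^sub>k y\<close> vanishes.\<close>

lemma tridiagonal_raises_top_index:
  assumes zero: "\<And>i j. \<lbrakk>i \<le> d; j \<le> d; \<bar>int i - int j\<bar> > 1\<rbrakk> \<Longrightarrow> F i * X * F j = 0"
    and nz: "\<And>i j. \<lbrakk>i \<le> d; j \<le> d; \<bar>int i - int j\<bar> = 1\<rbrakk> \<Longrightarrow> F i * X * F j \<noteq> 0"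
    and k: "k < d" and y: "top_index k y"
  shows "top_index (k + 1) ((X - scale t 1) * y)"
proof -
  have shift: "F r * ((X - scale t 1) * y) = F r * X * F k * y" if r: "k < r" "r \<le> d" for r
  proof -
    have yr: "F r * y = 0" using y r by (simp add: top_index_def)
    have "F r * ((X - scale t 1) * y) = F r * X * y - scale t (F r * y)"
      by (simp add: algebra_simps scale_mult_left scale_mult_right)
    also have "\<dots> = (\<Sum>s\<le>d. F r * X * F s * y)"
      by (simp add: yr decompose)
    also have "\<dots> = (\<Sum>s\<in>{k}. F r * X * F s * y)"
    proof (rule sum.mono_neutral_right)
      show "\<forall>s\<in>{..d} - {k}. F r * X * F s * y = 0"
      proof
        fix s assume s: "s \<in> {..d} - {k}"
        show "F r * X * F s * y = 0"
        proof (cases "s < k")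
          case True
          then show ?thesis using zero[of r s] r s by simp
        next
          case False
          then have "F s * y = 0" using y s by (simp add: top_index_def)
          then show ?thesis by (simp add: mult.assoc)
        qed
      qed
    qed (use k in auto)
    finally show ?thesis by simp
  qed
  have "F (k + 1) * X * F k * y \<noteq> 0"
    using k y nz[of "k + 1" k] by (intro rank_one_cancel) (simp_all add: top_index_def)
  moreover have "F r * X * F k * y = 0" if "k + 1 < r" "r \<le> d" for r
    using zero[of r k] that by simp
  ultimately show ?thesis using shift k by (auto simp: top_index_def)
qed

lemma tridiagonal_product_raises_top_index:
  assumes zero: "\<And>i j. \<lbrakk>i \<le> d; j \<le> d; \<bar>int i - int j\<bar> > 1\<rbrakk> \<Longrightarrow> F i * X * F j = 0"
    and nz: "\<And>i j. \<lbrakk>i \<le> d; j \<le> d; \<bar>int i - int j\<bar> = 1\<rbrakk> \<Longrightarrow> F i * X * F j \<noteq> 0"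
    and "k + length ts \<le> d" and "top_index k y"
  shows "top_index (k + length ts) (prod_list (map (\<lambda>t. X - scale t 1) ts) * y)"
  using assms(3)
proof (induction ts)
  case Nil
  with assms(4) show ?case by simp
next
  case (Cons t ts)
  then have "top_index (k + length ts + 1)
      ((X - scale t 1) * (prod_list (map (\<lambda>t. X - scale t 1) ts) * y))"
    by (intro tridiagonal_raises_top_index zero nz) simp_all
  then show ?case by (simp add: mult.assoc)
qed

text \<open>The sum over all indices and the rank-one condition do not see the order of the
  idempotents; reversal turns smallest indices into largest ones.\<close>

lemma reversed_frame: "idempotent_frame scale d rep (\<lambda>i. F (d - i))"
proof unfold_locales
  show "F (d - i) * F (d - j) = (if i = j then F (d - i) else 0)" if "i \<le> d" "j \<le> d" for i j
  proof -
    have "d - i = d - j \<longleftrightarrow> i = j" using that by arith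
    then show ?thesis by (simp add: orthogonal)
  qed
  show "(\<Sum>i\<le>d. F (d - i)) = 1"
    using sum.nat_diff_reindex[of F "Suc d"] sum_one by (simp add: lessThan_Suc_atMost)
  show "F (d - i) \<noteq> 0" for i
    by (simp add: nonzero)
  show "\<exists>u v. \<forall>p<d + 1. \<forall>q<d + 1. rep (F (d - i)) $$ (p, q) = u p * v q" for i
    by (rule rank_one) simp
qed

end

section \<open>Multiplicity-free elements\<close>

context matrix_algebra
begin

text \<open>Matrices whose columns are eigenvectors of \<open>A\<close> turn all polynomials in \<open>A\<close> into diagonal
  matrices at once; the following relation records the diagonal.\<close>

definition diagonal_on :: "'k mat \<Rightarrow> 'a \<Rightarrow> (nat \<Rightarrow> 'k) \<Rightarrow> bool" where
  "diagonal_on P x f \<longleftrightarrow> rep x * P = P * mat_diag (d + 1) f"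

lemma diagonal_on_iff:
  assumes P: "P \<in> carrier_mat (d + 1) (d + 1)"
  shows "diagonal_on P x f \<longleftrightarrow>
    (\<forall>p<d + 1. \<forall>j<d + 1. (rep x * P) $$ (p, j) = f j * P $$ (p, j))"
proof -
  have "P * mat_diag (d + 1) f = Matrix.mat (d + 1) (d + 1) (\<lambda>(p, j). P $$ (p, j) * f j)"
    by (rule mat_diag_mult_right[OF P])
  then show ?thesis
    using P unfolding diagonal_on_def
    by (auto simp: mat_eq_iff mult.commute simp del: index_mult_mat(1))
qed

lemma diagonal_on_cong:
  assumes "P \<in> carrier_mat (d + 1) (d + 1)" "diagonal_on P x f" "\<And>j. j \<le> d \<Longrightarrow> f j = g j"
  shows "diagonal_on P x g"
  using assms by (simp add: diagonal_on_iff less_Suc_eq_le del: index_mult_mat(1))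

lemma diagonal_on_one:
  assumes "P \<in> carrier_mat (d + 1) (d + 1)"
  shows "diagonal_on P 1 (\<lambda>_. 1)"
  using assms by (simp add: diagonal_on_def rep_one)

lemma diagonal_on_mult:
  assumes P: "P \<in> carrier_mat (d + 1) (d + 1)" and x: "diagonal_on P x f" and y: "diagonal_on P y g"
  shows "diagonal_on P (x * y) (\<lambda>j. f j * g j)"
proof -
  have "rep x * rep y * P = rep x * (rep y * P)"
    using P by (intro assoc_mult_mat[of _ "d + 1" "d + 1" _ "d + 1" _ "d + 1"]) auto
  also have "\<dots> = rep x * (P * mat_diag (d + 1) g)" using y by (simp add: diagonal_on_def)
  also have "\<dots> = rep x * P * mat_diag (d + 1) g"
    using P by (intro assoc_mult_mat[symmetric, of _ "d + 1" "d + 1" _ "d + 1" _ "d + 1"]) auto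
  also have "\<dots> = P * mat_diag (d + 1) f * mat_diag (d + 1) g" using x by (simp add: diagonal_on_def)
  also have "\<dots> = P * (mat_diag (d + 1) f * mat_diag (d + 1) g)"
    using P by (intro assoc_mult_mat[of _ "d + 1" "d + 1" _ "d + 1" _ "d + 1"]) auto
  finally show ?thesis by (simp add: diagonal_on_def rep_mult)
qed

lemma diagonal_on_add:
  assumes P: "P \<in> carrier_mat (d + 1) (d + 1)" and x: "diagonal_on P x f" and y: "diagonal_on P y g"
  shows "diagonal_on P (x + y) (\<lambda>j. f j + g j)"
proof -
  have "rep (x + y) * P = rep x * P + rep y * P"
    unfolding rep_add by (rule add_mult_distrib_mat[OF rep_carrier rep_carrier P])
  then show ?thesis
    using x y P by (simp add: diagonal_on_iff distrib_right del: index_mult_mat(1))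
qed

lemma diagonal_on_scale:
  assumes P: "P \<in> carrier_mat (d + 1) (d + 1)" and x: "diagonal_on P x f"
  shows "diagonal_on P (scale c x) (\<lambda>j. c * f j)"
proof -
  have "rep (scale c x) * P = c \<cdot>\<^sub>m (rep x * P)"
    unfolding rep_scale by (rule mult_smult_assoc_mat[OF rep_carrier P])
  then show ?thesis
    using x P by (simp add: diagonal_on_iff mult.assoc del: index_mult_mat(1))
qed

lemma diagonal_on_diff_const:
  assumes P: "P \<in> carrier_mat (d + 1) (d + 1)" and x: "diagonal_on P x f"
  shows "diagonal_on P (x - scale t 1) (\<lambda>j. f j - t)"
  using diagonal_on_add[OF P x diagonal_on_scale[OF P diagonal_on_one[OF P], of "- t"]] by simp

lemma diagonal_on_zero:
  assumes P: "P \<in> carrier_mat (d + 1) (d + 1)"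
  shows "diagonal_on P 0 (\<lambda>_. 0)"
  using diagonal_on_scale[OF P diagonal_on_one[OF P], of 0] by simp

lemma diagonal_on_sum:
  assumes P: "P \<in> carrier_mat (d + 1) (d + 1)" and "\<And>i. i \<in> N \<Longrightarrow> diagonal_on P (x i) (f i)"
  shows "diagonal_on P (\<Sum>i\<in>N. x i) (\<lambda>j. \<Sum>i\<in>N. f i j)"
  using assms(2)
  by (induction N rule: infinite_finite_induct)
    (simp_all add: diagonal_on_zero[OF P] diagonal_on_add[OF P])

lemma diagonal_on_prod_list:
  assumes P: "P \<in> carrier_mat (d + 1) (d + 1)" and "\<And>i. i \<in> set is \<Longrightarrow> diagonal_on P (x i) (f i)"
  shows "diagonal_on P (\<Prod>i\<leftarrow>is. x i) (\<lambda>j. \<Prod>i\<leftarrow>is. f i j)"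
  using assms(2)
  by (induction "is") (simp_all add: diagonal_on_one[OF P] diagonal_on_mult[OF P])

lemma diagonal_on_unique:
  assumes P: "P \<in> carrier_mat (d + 1) (d + 1)" and Q: "Q \<in> carrier_mat (d + 1) (d + 1)"
    and PQ: "P * Q = 1\<^sub>m (d + 1)" and x: "diagonal_on P x f" and y: "diagonal_on P y f"
  shows "x = y"
proof -
  have "rep z = rep z * P * Q" for z
    using assoc_mult_mat[OF rep_carrier P Q, of z] PQ by (simp add: right_mult_one_mat[OF rep_carrier])
  moreover have "rep x * P = rep y * P" using x y by (simp add: diagonal_on_def)
  ultimately have "rep x = rep y" by metis
  then show ?thesis by (simp add: rep_inject)
qed

text \<open>Each factor \<open>(A - \<theta>\<^sub>k)/(\<theta>\<^sub>i - \<theta>\<^sub>k)\<close> is a Lagrange interpolation factor, so the product takes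
  the value \<open>\<delta>\<^sub>i\<^sub>j\<close> at \<open>\<theta>\<^sub>j\<close>.\<close>

lemma primitive_idempotent_diagonal:
  assumes P: "P \<in> carrier_mat (d + 1) (d + 1)" and A: "diagonal_on P A \<theta>"
    and inj: "inj_on \<theta> {0..d}" and i: "i \<le> d"
  shows "diagonal_on P (primitive_idempotent scale d A \<theta> i) (\<lambda>j. of_bool (i = j))"
proof -
  let ?is = "filter (\<lambda>k. k \<noteq> i) [0..<d + 1]"
  have diag: "diagonal_on P (primitive_idempotent scale d A \<theta> i)
      (\<lambda>j. \<Prod>k\<leftarrow>?is. 1 / (\<theta> i - \<theta> k) * (\<theta> j - \<theta> k))"
    unfolding primitive_idempotent_def
    by (intro diagonal_on_prod_list diagonal_on_scale diagonal_on_diff_const P A)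
  show ?thesis
  proof (rule diagonal_on_cong[OF P diag])
    fix j assume j: "j \<le> d"
    show "(\<Prod>k\<leftarrow>?is. 1 / (\<theta> i - \<theta> k) * (\<theta> j - \<theta> k)) = of_bool (i = j)"
    proof (cases "i = j")
      case True
      have "1 / (\<theta> i - \<theta> k) * (\<theta> j - \<theta> k) = 1" if "k \<in> set ?is" for k
        using that True i inj_onD[OF inj, of i k] by (auto simp del: upt_Suc)
      then have "map (\<lambda>k. 1 / (\<theta> i - \<theta> k) * (\<theta> j - \<theta> k)) ?is = map (\<lambda>_. 1) ?is"
        by (rule map_cong[OF refl])
      then show ?thesis using True by (simp only: map_replicate_const prod_list_replicate) simp
    next
      case False
      then have "0 \<in> (\<lambda>k. 1 / (\<theta> i - \<theta> k) * (\<theta> j - \<theta> k)) ` set ?is"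
        using j by (intro image_eqI[of _ _ j]) auto
      then have "(\<Prod>k\<leftarrow>?is. 1 / (\<theta> i - \<theta> k) * (\<theta> j - \<theta> k)) = 0"
        unfolding prod_list_zero_iff set_map .
      then show ?thesis using False by simp
    qed
  qed
qed

text \<open>The columns of \<open>P\<close> are eigenvectors, one for each \<open>\<theta>\<^sub>j\<close>. If \<open>P c = 0\<close>, then applying the
  \<open>i\<close>-th primitive idempotent isolates the \<open>i\<close>-th column and gives \<open>c\<^sub>i = 0\<close>; so \<open>P\<close> is
  invertible. In the basis of the columns the primitive idempotents are the diagonal matrix
  units, which have rank one.\<close>

lemma idempotent_ordering_frame:
  assumes "idempotent_ordering scale d rep A E \<theta>"
  shows idempotent_ordering_imp_frame: "idempotent_frame scale d rep E"
    and idempotent_ordering_spectral: "A = (\<Sum>i\<le>d. scale (\<theta> i) (E i))"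
proof -
  have bij: "bij_betw \<theta> {0..d} (alg_eigenvalues rep A)"
    and E: "\<And>i. i \<le> d \<Longrightarrow> E i = primitive_idempotent scale d A \<theta> i"
    using assms by (auto simp: idempotent_ordering_def eigenvalue_ordering_def)
  have inj: "inj_on \<theta> {0..d}" using bij by (rule bij_betw_imp_inj_on)
  have "\<exists>v. eigenvector (rep A) v (\<theta> j)" if "j \<le> d" for j
  proof -
    have "\<theta> j \<in> alg_eigenvalues rep A"
      using bij_betwE[OF bij] that by simp
    then show ?thesis by (simp add: alg_eigenvalues_def eigenvalue_def)
  qed
  then obtain v where v: "\<And>j. j \<le> d \<Longrightarrow> eigenvector (rep A) (v j) (\<theta> j)" by metis
  define P where "P = Matrix.mat (d + 1) (d + 1) (\<lambda>(p, j). v j $ p)"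
  have P: "P \<in> carrier_mat (d + 1) (d + 1)" by (simp add: P_def)
  have v_carrier: "v j \<in> carrier_vec (d + 1)" if "j \<le> d" for j
    using v[OF that] by (simp add: eigenvector_def)
  have colP: "col P j = v j" if "j \<le> d" for j
    using that v_carrier[OF that] by (intro eq_vecI) (auto simp: P_def)
  have A: "diagonal_on P A \<theta>"
    unfolding diagonal_on_iff[OF P]
  proof (intro allI impI)
    fix p j assume pj: "p < d + 1" "j < d + 1"
    then have "(rep A * P) $$ (p, j) = (rep A *\<^sub>v v j) $ p"
      using P colP[of j] by simp
    also have "\<dots> = (\<theta> j \<cdot>\<^sub>v v j) $ p"
      using v[of j] pj by (simp add: eigenvector_def)
    also have "\<dots> = \<theta> j * P $$ (p, j)"
      using pj v_carrier[of j] by (simp add: P_def)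
    finally show "(rep A * P) $$ (p, j) = \<theta> j * P $$ (p, j)" .
  qed
  have Ed: "diagonal_on P (E i) (\<lambda>j. of_bool (i = j))" if "i \<le> d" for i
    using primitive_idempotent_diagonal[OF P A inj that] by (simp add: E that)
  have "det P \<noteq> 0"
  proof
    assume "det P = 0"
    then obtain c where c: "c \<in> carrier_vec (d + 1)" "c \<noteq> 0\<^sub>v (d + 1)" "P *\<^sub>v c = 0\<^sub>v (d + 1)"
      using det_0_iff_vec_prod_zero_field[OF P] by blast
    have "c $ i = 0" if i: "i \<le> d" for i
    proof -
      have "(rep (E i) * P) *\<^sub>v c = rep (E i) *\<^sub>v (P *\<^sub>v c)"
        by (rule assoc_mult_mat_vec[OF rep_carrier P c(1)])
      also have "\<dots> = 0\<^sub>v (d + 1)" unfolding c(3) by (intro eq_vecI) (auto simp: scalar_prod_def)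
      finally have z: "(rep (E i) * P) *\<^sub>v c = 0\<^sub>v (d + 1)" .
      have "c $ i * v i $ p = 0" if p: "p < d + 1" for p
      proof -
        have "((rep (E i) * P) *\<^sub>v c) $ p = (\<Sum>k<d + 1. (rep (E i) * P) $$ (p, k) * c $ k)"
          using p P c(1) by (auto simp: scalar_prod_def atLeast0LessThan
              simp del: index_mult_mat(1) sum.lessThan_Suc intro!: sum.cong)
        also have "\<dots> = (\<Sum>k<d + 1. if k = i then P $$ (p, k) * c $ k else 0)"
          using Ed[OF i] p by (intro sum.cong) (auto simp: diagonal_on_iff[OF P])
        also have "\<dots> = v i $ p * c $ i" using i p by (simp add: P_def)
        finally show ?thesis using z p by (simp add: mult.commute)
      qed
      moreover have "\<exists>p<d + 1. v i $ p \<noteq> 0"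
      proof (rule ccontr)
        assume "\<not> ?thesis"
        then have "v i = 0\<^sub>v (d + 1)" using v_carrier[OF i] by (intro eq_vecI) auto
        with v[OF i] show False by (simp add: eigenvector_def)
      qed
      ultimately show ?thesis by auto
    qed
    then have "c = 0\<^sub>v (d + 1)" using c(1) by (intro eq_vecI) auto
    with c(2) show False by simp
  qed
  from det_non_zero_imp_unit[OF P this, of "()"] obtain Q
    where Q: "Q \<in> carrier_mat (d + 1) (d + 1)" and PQ: "P * Q = 1\<^sub>m (d + 1)"
    by (auto simp: Units_def ring_mat_def)
  note unique = diagonal_on_unique[OF P Q PQ]
  show "A = (\<Sum>i\<le>d. scale (\<theta> i) (E i))"
  proof (rule unique[OF A])
    have "diagonal_on P (\<Sum>i\<le>d. scale (\<theta> i) (E i)) (\<lambda>j. \<Sum>i\<le>d. \<theta> i * of_bool (i = j))"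
      by (intro diagonal_on_sum diagonal_on_scale P Ed) simp
    then show "diagonal_on P (\<Sum>i\<le>d. scale (\<theta> i) (E i)) \<theta>"
      by (rule diagonal_on_cong[OF P]) (simp add: of_bool_def if_distrib cong: if_cong)
  qed
  show "idempotent_frame scale d rep E"
  proof unfold_locales
    fix i j assume ij: "i \<le> d" "j \<le> d"
    have prod: "diagonal_on P (E i * E j) (\<lambda>k. of_bool (i = k) * of_bool (j = k))"
      by (intro diagonal_on_mult P Ed ij)
    show "E i * E j = (if i = j then E i else 0)"
    proof (cases "i = j")
      case True
      have "diagonal_on P (E i * E j) (\<lambda>k. of_bool (i = k))"
        by (rule diagonal_on_cong[OF P prod]) (simp add: True)
      then have "E i * E j = E i" by (rule unique[OF _ Ed[OF ij(1)]])
      with True show ?thesis by simp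
    next
      case False
      have "diagonal_on P (E i * E j) (\<lambda>k. 0)"
        by (rule diagonal_on_cong[OF P prod]) (use False in auto)
      then have "E i * E j = 0" by (rule unique[OF _ diagonal_on_zero[OF P]])
      with False show ?thesis by simp
    qed
  next
    have "diagonal_on P (\<Sum>i\<le>d. E i) (\<lambda>j. \<Sum>i\<le>d. of_bool (i = j))"
      by (intro diagonal_on_sum P Ed) simp
    then have "diagonal_on P (\<Sum>i\<le>d. E i) (\<lambda>j. 1)"
      by (rule diagonal_on_cong[OF P]) (simp add: of_bool_def)
    then show "(\<Sum>i\<le>d. E i) = 1" by (rule unique[OF _ diagonal_on_one[OF P]])
  next
    fix i assume i: "i \<le> d"
    show "E i \<noteq> 0"
    proof
      assume zero: "E i = 0"
      have "v i $ p = 0" if p: "p < d + 1" for p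
      proof -
        have "(rep (E i) * P) $$ (p, i) = P $$ (p, i)"
          using Ed[OF i] p i by (simp add: diagonal_on_iff[OF P] del: index_mult_mat(1))
        moreover have "(rep (E i) * P) $$ (p, i) = 0"
          using diagonal_on_zero[OF P] p i by (simp add: zero diagonal_on_iff[OF P]
              del: index_mult_mat(1))
        ultimately show ?thesis using p i by (simp add: P_def)
      qed
      then have "v i = 0\<^sub>v (d + 1)" using v_carrier[OF i] by (intro eq_vecI) auto
      with v[OF i] show False by (simp add: eigenvector_def)
    qed
  next
    fix i assume i: "i \<le> d"
    have "rep (E i) = rep (E i) * P * Q"
      using assoc_mult_mat[OF rep_carrier P Q, of "E i"] PQ
      by (simp add: right_mult_one_mat[OF rep_carrier])
    moreover have "(rep (E i) * P * Q) $$ (p, q) = P $$ (p, i) * Q $$ (i, q)"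
      if pq: "p < d + 1" "q < d + 1" for p q
    proof -
      have "(rep (E i) * P * Q) $$ (p, q) = (\<Sum>k<d + 1. (rep (E i) * P) $$ (p, k) * Q $$ (k, q))"
        using pq P Q by (subst index_mult_mat(1))
          (auto simp: scalar_prod_def atLeast0LessThan simp del: index_mult_mat(1) intro!: sum.cong)
      also have "\<dots> = (\<Sum>k<d + 1. if k = i then P $$ (p, k) * Q $$ (k, q) else 0)"
        using Ed[OF i] pq by (intro sum.cong) (auto simp: diagonal_on_iff[OF P])
      also have "\<dots> = P $$ (p, i) * Q $$ (i, q)" using i by simp
      finally show ?thesis .
    qed
    ultimately have "\<forall>p<d + 1. \<forall>q<d + 1. rep (E i) $$ (p, q) = P $$ (p, i) * Q $$ (i, q)"
      by metis
    then show "\<exists>u v. \<forall>p<d + 1. \<forall>q<d + 1. rep (E i) $$ (p, q) = u p * v q"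
      by (intro exI[of _ "\<lambda>p. P $$ (p, i)"] exI[of _ "\<lambda>q. Q $$ (i, q)"])
  qed
qed

end

section \<open>Nonvanishing of the split traces\<close>

text \<open>The ordered eigenvalues are parameters, so that the Leonard system with the order of the
  \<open>E\<^sub>i\<close> reversed is again an instance, with \<open>\<theta>\<close> reversed as well.\<close>

locale leonard_frames =
  E: idempotent_frame scale d rep E + Es: idempotent_frame scale d rep Es
  for scale :: "'k::field \<Rightarrow> 'a::ring_1 \<Rightarrow> 'a" and d :: nat and rep :: "'a \<Rightarrow> 'k mat"
    and E Es :: "nat \<Rightarrow> 'a" +
  fixes A As :: 'a and \<theta> \<theta>s :: "nat \<Rightarrow> 'k"
  assumes A_spec: "A = E.spec \<theta>" and As_spec: "As = Es.spec \<theta>s"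
    and zero: "\<lbrakk>i \<le> d; j \<le> d; \<bar>int i - int j\<bar> > 1\<rbrakk> \<Longrightarrow> E i * As * E j = 0"
    and nonzero: "\<lbrakk>i \<le> d; j \<le> d; \<bar>int i - int j\<bar> = 1\<rbrakk> \<Longrightarrow> E i * As * E j \<noteq> 0"
    and dual_zero: "\<lbrakk>i \<le> d; j \<le> d; \<bar>int i - int j\<bar> > 1\<rbrakk> \<Longrightarrow> Es i * A * Es j = 0"
    and dual_nonzero: "\<lbrakk>i \<le> d; j \<le> d; \<bar>int i - int j\<bar> = 1\<rbrakk> \<Longrightarrow> Es i * A * Es j \<noteq> 0"
begin

lemma reversed: "leonard_frames scale d rep (\<lambda>i. E (d - i)) Es A As (\<lambda>i. \<theta> (d - i)) \<theta>s"
proof -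
  interpret R: idempotent_frame scale d rep "\<lambda>i. E (d - i)" by (rule E.reversed_frame)
  show ?thesis
  proof unfold_locales
    show "A = R.spec (\<lambda>i. \<theta> (d - i))"
      using sum.nat_diff_reindex[of "\<lambda>i. scale (\<theta> i) (E i)" "Suc d"]
      by (simp add: A_spec E.spec_def R.spec_def lessThan_Suc_atMost)
    show "As = Es.spec \<theta>s" by (rule As_spec)
    show "E (d - i) * As * E (d - j) = 0" if "i \<le> d" "j \<le> d" "\<bar>int i - int j\<bar> > 1" for i j
      using that by (intro zero) (auto simp: of_nat_diff)
    show "E (d - i) * As * E (d - j) \<noteq> 0" if "i \<le> d" "j \<le> d" "\<bar>int i - int j\<bar> = 1" for i j
      using that by (intro nonzero) (auto simp: of_nat_diff)
  qed (use dual_zero dual_nonzero in auto)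
qed

text \<open>If \<open>E\<^sup>*\<^sub>0 w\<close> vanished, only the components \<open>E\<^sup>*\<^sub>j w\<close> with \<open>1 \<le> j \<le> i\<close> would be left, and
  \<open>(A\<^sup>* - \<theta>\<^sup>*\<^sub>1) \<cdots> (A\<^sup>* - \<theta>\<^sup>*\<^sub>i)\<close> would annihilate \<open>w\<close>. But these \<open>i\<close> factors lower the smallest
  \<open>k\<close> with \<open>E\<^sub>k w \<noteq> 0\<close> to exactly \<open>k - i\<close>, which is possible because \<open>k \<ge> i\<close>.\<close>

lemma zero_component_nonzero:
  assumes i: "i \<le> d" and w: "w \<noteq> 0"
    and low: "\<And>r. r < i \<Longrightarrow> E r * w = 0"
    and high: "\<And>r. \<lbrakk>i < r; r \<le> d\<rbrakk> \<Longrightarrow> Es r * w = 0"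
  shows "Es 0 * w \<noteq> 0"
proof
  assume w0: "Es 0 * w = 0"
  interpret R: leonard_frames scale d rep "\<lambda>i. E (d - i)" Es A As "\<lambda>i. \<theta> (d - i)" \<theta>s
    by (rule reversed)
  define ts where "ts = map \<theta>s [1..<Suc i]"
  define X where "X = prod_list (map (\<lambda>t. As - scale t 1) ts)"
  have annihilates: "X * w = 0"
  proof (rule Es.eq_zero_if_components_zero)
    fix s assume s: "s \<le> d"
    have "Es s * (X * w) = scale (\<Prod>t\<leftarrow>ts. \<theta>s s - t) (Es s * w)"
      unfolding X_def As_spec Es.prod_list_spec_diff
      by (simp add: mult.assoc[symmetric] Es.idem_mult_spec[OF s] E.scale_mult_left)
    also have "\<dots> = 0"
    proof (cases "1 \<le> s \<and> s \<le> i")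
      case True
      then have "0 \<in> (\<lambda>k. \<theta>s s - \<theta>s k) ` set [1..<Suc i]"
        by (intro image_eqI[of _ _ s]) auto
      then have "(\<Prod>t\<leftarrow>ts. \<theta>s s - t) = 0"
        by (simp add: ts_def prod_list_zero_iff image_image del: upt_Suc set_upt)
      then show ?thesis by simp
    next
      case False
      then have "Es s * w = 0" using w0 high s by (cases "s = 0") auto
      then show ?thesis by simp
    qed
    finally show "Es s * (X * w) = 0" .
  qed
  have ex: "\<exists>k\<le>d. E k * w \<noteq> 0" using E.eq_zero_if_components_zero w by blast
  define k where "k = (LEAST k. k \<le> d \<and> E k * w \<noteq> 0)"
  have k: "k \<le> d" "E k * w \<noteq> 0" using LeastI_ex[OF ex] by (auto simp: k_def)
  have least: "E r * w = 0" if "r < k" for r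
    using not_less_Least[of r "\<lambda>k. k \<le> d \<and> E k * w \<noteq> 0"] that k(1) by (auto simp: k_def)
  have "i \<le> k" using low k(2) by (meson not_le)
  \<comment> \<open>In the reversed order the smallest index \<open>k\<close> becomes the largest index \<open>d - k\<close>, and \<open>k \<ge> i\<close>
    leaves room to raise it \<open>i\<close> times.\<close>
  have "R.E.top_index (d - k) w" using k least by (auto simp: R.E.top_index_def)
  moreover have "length ts = i" by (simp add: ts_def)
  then have "d - k + length ts \<le> d" using \<open>i \<le> k\<close> k(1) by arith
  ultimately have "R.E.top_index (d - k + length ts) (X * w)"
    unfolding X_def
    by (intro R.E.tridiagonal_product_raises_top_index R.zero R.nonzero)
  with annihilates show False by (simp add: R.E.top_index_def)
qed

theorem tau_trace_nonzero:
  assumes i: "i \<le> d"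
  shows "alg_trace rep (alg_poly scale (tau_poly \<theta> i) A * Es 0) \<noteq> 0"
proof -
  define T where "T = alg_poly scale (tau_poly \<theta> i) A"
  have T_spec: "T = E.spec (\<lambda>r. \<Prod>h<i. \<theta> r - \<theta> h)"
    by (simp add: T_def A_spec E.alg_poly_spec tau_poly_def poly_prod)
  have "(\<Prod>t\<leftarrow>map \<theta> [0..<i]. x - t) = (\<Prod>h<i. x - \<theta> h)" for x
    by (simp add: prod.list_conv_set_nth atLeast0LessThan)
  then have T_prod: "T = prod_list (map (\<lambda>t. A - scale t 1) (map \<theta> [0..<i]))"
    unfolding T_spec A_spec E.prod_list_spec_diff by simp
  have "Es.top_index 0 (Es 0)"
    by (simp add: Es.top_index_def Es.orthogonal Es.nonzero)
  then have "Es.top_index (0 + length (map \<theta> [0..<i])) (T * Es 0)"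
    unfolding T_prod using i
    by (intro Es.tridiagonal_product_raises_top_index dual_zero dual_nonzero) simp_all
  then have top: "Es.top_index i (T * Es 0)" by simp
  have "Es 0 * (T * Es 0) \<noteq> 0"
  proof (rule zero_component_nonzero[OF i])
    show "T * Es 0 \<noteq> 0" using top by (auto simp: Es.top_index_def)
    show "E r * (T * Es 0) = 0" if "r < i" for r
    proof -
      have "E r * T = scale (\<Prod>h<i. \<theta> r - \<theta> h) (E r)"
        unfolding T_spec using that i by (intro E.idem_mult_spec) simp
      also have "(\<Prod>h<i. \<theta> r - \<theta> h) = 0" using that by auto
      finally have "E r * T = 0" by simp
      then show ?thesis by (simp add: mult.assoc[symmetric])
    qed
    show "Es r * (T * Es 0) = 0" if "i < r" "r \<le> d" for r
      using top that by (simp add: Es.top_index_def)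
  qed
  then show ?thesis unfolding T_def by (intro Es.trace_nonzero) simp_all
qed

text \<open>For the reversed system \<open>\<tau>\<^sub>i\<close> is \<open>\<eta>\<^sub>i\<close>.\<close>

corollary eta_trace_nonzero:
  assumes "i \<le> d"
  shows "alg_trace rep (alg_poly scale (eta_poly d \<theta> i) A * Es 0) \<noteq> 0"
  using leonard_frames.tau_trace_nonzero[OF reversed assms]
  by (simp add: tau_poly_def eta_poly_def)

end

section \<open>The switching elements\<close>

theorem lemma5p3:
  fixes scale :: "'k::field \<Rightarrow> 'a::ring_1 \<Rightarrow> 'a"
    and d :: nat
    and rep :: "'a \<Rightarrow> 'k mat"
    and A As :: 'a
    and E Es :: "nat \<Rightarrow> 'a"
    and \<theta> \<theta>s \<phi>1 \<phi>2 :: "nat \<Rightarrow> 'k"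
  assumes "leonard_system scale d rep A E As Es"
    and "idempotent_ordering scale d rep A E \<theta>"
    and "idempotent_ordering scale d rep As Es \<theta>s"
    and "\<And>i. i \<in> {1..d} \<Longrightarrow> \<phi>1 i = first_split_sequence scale rep A Es \<theta> \<theta>s i"
    and "\<And>i. i \<in> {1..d} \<Longrightarrow> \<phi>2 i = second_split_sequence scale d rep A Es \<theta> \<theta>s i"
  shows "is_inverse_of
           (\<Sum>r=0..d. scale ((\<Prod>h=1..r. \<phi>1 h) / (\<Prod>h<r. \<phi>2 (d - h))) (E r))
           (switching_element scale d E \<phi>1 \<phi>2) \<and>
         is_inverse_of
           (\<Sum>r=0..d. scale ((\<Prod>h=1..r. \<phi>1 h) / (\<Prod>h=1..r. \<phi>2 h)) (Es r))
           (dual_switching_element scale d Es \<phi>1 \<phi>2)"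
proof -
  interpret L: leonard_system scale d rep A E As Es by (rule assms(1))
  interpret E: idempotent_frame scale d rep E
    by (rule L.idempotent_ordering_imp_frame[OF assms(2)])
  interpret Es: idempotent_frame scale d rep Es
    by (rule L.idempotent_ordering_imp_frame[OF assms(3)])
  interpret leonard_frames scale d rep E Es A As \<theta> \<theta>s
  proof unfold_locales
    show "A = E.spec \<theta>"
      unfolding E.spec_def by (rule L.idempotent_ordering_spectral[OF assms(2)])
    show "As = Es.spec \<theta>s"
      unfolding Es.spec_def by (rule L.idempotent_ordering_spectral[OF assms(3)])
  qed (use L.tridiag_zero L.tridiag_nonzero L.tridiag_dual_zero L.tridiag_dual_nonzero in auto)
  have "inj_on \<theta>s {0..d}"
    using assms(3) by (auto simp: idempotent_ordering_def eigenvalue_ordering_def bij_betw_def)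
  then have dist: "\<theta>s 0 - \<theta>s i \<noteq> 0" if "i \<in> {1..d}" for i
    using that inj_onD[of \<theta>s "{0..d}" 0 i] by auto
  have pred_le: "i - 1 \<le> d" if "i \<in> {1..d}" for i using that by auto
  have \<phi>1: "\<phi>1 i \<noteq> 0" if "i \<in> {1..d}" for i
    using that dist[OF that] tau_trace_nonzero[of i] tau_trace_nonzero[OF pred_le[OF that]]
    by (simp add: assms(4) first_split_sequence_def)
  have \<phi>2: "\<phi>2 i \<noteq> 0" if "i \<in> {1..d}" for i
    using that dist[OF that] eta_trace_nonzero[of i] eta_trace_nonzero[OF pred_le[OF that]]
    by (simp add: assms(5) second_split_sequence_def)
  have prods: "(\<Prod>h=1..r. \<phi>1 h) \<noteq> 0" "(\<Prod>h=1..r. \<phi>2 h) \<noteq> 0" "(\<Prod>h<r. \<phi>2 (d - h)) \<noteq> 0"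
    if "r \<le> d" for r
    using that by (auto simp: \<phi>1 \<phi>2)
  show ?thesis
    unfolding switching_element_def dual_switching_element_def atLeast0AtMost
      E.spec_def[symmetric] Es.spec_def[symmetric]
    by (intro conjI E.inverse_spec Es.inverse_spec) (simp_all add: prods del: prod_zero_iff One_nat_def)
qed

end
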